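(* Suppose there exist a sequence $(p_n)$ of Newman polynomials with $\deg p_n \to \infty$ and positive constants $c_0$, $\rho$ such that, for all $n$, $$ \|p_n\|_1 \ge c_0 \deg p_n \quad\text{and}\quad R(p_n) \le \rho\, \frac{1}{\deg p_n}. $$ Then for every $\rho' > \rho$ there exists an infinite sequence $(q_n)$ of Newman polynomials with $\deg q_n \to \infty$ such that $$ \|q_n\|_1 = o(\deg q_n) \ \text{ as } n \to \infty \quad\text{and}\quad R(q_n) \le \rho'\, \frac{1}{\deg q_n} \ \text{ for all } n. $$
   Context: A Newman polynomial is a polynomial in one variable all of whose coefficients are 0 or 1. For a polynomial $p(x) = \sum_{j=0}^d p_j x^j$ with $p_d \ne 0$, write $\deg p = d$, $\|p\|_\infty = \max_{0\le j\le d} |p_j|$ (the size of the maximal coefficient in absolute value), and $\|p\|_1 = \sum_{j=0}^d |p_j|$. Define $$ R(p) = \frac{\|p^2\|_\infty}{\|p\|_1^2}, $$ where $p^2$ is the square of the polynomial $p$. *)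

theory Defs
  imports
    "HOL-Computational_Algebra.Polynomial"
    "HOL-Library.Landau_Symbols"
begin

definition newman :: "real poly \<Rightarrow> bool" where
  "newman p \<longleftrightarrow> (\<forall>j. coeff p j = 0 \<or> coeff p j = 1)"

definition poly_norm_inf :: "real poly \<Rightarrow> real" where
  "poly_norm_inf p = Max ((\<lambda>j. \<bar>coeff p j\<bar>) ` {0..degree p})"

definition poly_norm1 :: "real poly \<Rightarrow> real" where
  "poly_norm1 p = (\<Sum>j=0..degree p. \<bar>coeff p j\<bar>)"

(* Only meaningful for p \<noteq> 0: division by zero gives poly_R 0 = 0. *)
definition poly_R :: "real poly \<Rightarrow> real" where
  "poly_R p = poly_norm_inf (p ^ 2) / (poly_norm1 p) ^ 2"

end

theory Submission
  imports Defs "HOL-Probability.Probability" "HOL-Real_Asymp.Real_Asymp"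
begin

text \<open>
  Thin the support of \<open>p\<close> (of degree \<open>d\<close>) at random, keeping every exponent below \<open>d\<close> with
  probability \<open>t = d powr (-1/8)\<close> and always keeping \<open>d\<close> itself, so that the degree does not change.
  The norm \<open>\<parallel>p\<parallel>\<^sub>1\<close> shrinks by a factor close to \<open>t\<close>. The coefficient of \<open>x^n\<close> in \<open>p\<^sup>2\<close> counts the
  disjoint pairs \<open>{i, n - i}\<close> in the support twice, up to the diagonal term, and each pair
  survives independently with probability \<open>t\<^sup>2\<close>. As \<open>t^4 d\<close> is much larger than \<open>ln d\<close>, Hoeffding's
  inequality and a union bound over \<open>n\<close> show that all coefficients are at most
  \<open>t\<^sup>2 \<parallel>p\<^sup>2\<parallel>\<^sub>\<infinity> + O(\<epsilon> t\<^sup>2 d)\<close>, where \<open>\<epsilon>\<close> is arbitrarily small and \<open>t\<^sup>2 d\<close> is at most of the order of \<open>(t \<parallel>p\<parallel>\<^sub>1)\<^sup>2 / d\<close>. Hence \<open>R\<close> changes only by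
  a factor close to 1, while \<open>\<parallel>q\<parallel>\<^sub>1\<close> is about \<open>t \<parallel>p\<parallel>\<^sub>1 = o(d)\<close>.
\<close>

section \<open>Concentration for binomial random subsets\<close>

text \<open>The blocks \<open>K j\<close> are disjoint, so the events "\<open>K j\<close> survives
  entirely" are independent, each of probability \<open>t ^ c\<close>, and Hoeffding's inequality
  applies to their indicators. The bound \<open>m\<close> allows one common estimate for index sets
  of different sizes.\<close>

lemma binomial_subset_concentration:
  fixes t x m :: real and K :: "'b \<Rightarrow> 'a set"
  assumes A: "finite A" and L: "finite L" and t: "0 \<le> t" "t \<le> 1"
    and disj: "disjoint_family_on K L"
    and K: "\<And>j. j \<in> L \<Longrightarrow> K j \<subseteq> A" "\<And>j. j \<in> L \<Longrightarrow> card (K j) = c"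
    and x: "x > 0" and m: "real (card L) \<le> m"
  shows "measure_pmf.prob (Pi_pmf A False (\<lambda>_. bernoulli_pmf t))
           {f. x \<le> \<bar>real (card {j\<in>L. \<forall>i\<in>K j. f i}) - real (card L) * t ^ c\<bar>}
         \<le> 2 * exp (- 2 * x\<^sup>2 / m)"
proof (cases "L = {}")
  case True
  then show ?thesis using x by simp
next
  case False
  define P where "P = Pi_pmf A False (\<lambda>_. bernoulli_pmf t)"
  define X :: "'b \<Rightarrow> ('a \<Rightarrow> bool) \<Rightarrow> real" where "X = (\<lambda>j f. of_bool (\<forall>i\<in>K j. f i))"
  have fin_K: "finite (K j)" if "j \<in> L" for j
    using K(1)[OF that] A by (rule finite_subset)
  have "prob_space.indep_vars (measure_pmf P) (\<lambda>_. count_space UNIV) (\<lambda>i f. f i) A"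
    unfolding P_def using A by (rule indep_vars_Pi_pmf)
  then have "prob_space.indep_vars (measure_pmf P) (\<lambda>j. PiM (K j) (\<lambda>_. count_space UNIV))
      (\<lambda>j f. restrict (\<lambda>i. f i) (K j)) L"
    by (rule prob_space.indep_vars_restrict[OF measure_pmf.prob_space_axioms]) (use K disj in auto)
  then have "prob_space.indep_vars (measure_pmf P) (\<lambda>_. borel)
      (\<lambda>j f. (\<lambda>g. of_bool (\<forall>i\<in>K j. g i) :: real) (restrict f (K j))) L"
  proof (rule prob_space.indep_vars_compose2[OF measure_pmf.prob_space_axioms])
    fix j assume j: "j \<in> L"
    have [measurable]: "Measurable.pred (PiM (K j) (\<lambda>_. count_space UNIV)) (\<lambda>g. \<forall>i\<in>K j. g i)"
      by (rule pred_intros_finite) (use fin_K[OF j] in \<open>auto intro!: measurable_component_singleton\<close>)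
    show "(\<lambda>g. of_bool (\<forall>i\<in>K j. g i) :: real) \<in> borel_measurable (PiM (K j) (\<lambda>_. count_space UNIV))"
      by measurable
  qed
  then have indep: "prob_space.indep_vars (measure_pmf P) (\<lambda>_. borel) X L"
    by (simp add: X_def)
  interpret H: Hoeffding_ineq "measure_pmf P" L X "\<lambda>_. 0" "\<lambda>_. 1"
      "\<Sum>j\<in>L. measure_pmf.expectation P (X j)"
    using L indep by unfold_locales (auto simp: X_def)
  have E: "measure_pmf.expectation P (X j) = t ^ c" if j: "j \<in> L" for j
  proof -
    have "X j = indicator {f. \<forall>i\<in>K j. f i}"
      by (auto simp: X_def indicator_def fun_eq_iff)
    then have "measure_pmf.expectation P (X j) = measure_pmf.prob P {f. \<forall>i\<in>K j. f i}"
      by simp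
    \<comment> \<open>Written as a box over all of \<open>A\<close>, the event has a product
      probability; coordinates outside \<open>K j\<close> contribute the factor 1.\<close>
    also have "{f. \<forall>i\<in>K j. f i} = Pi A (\<lambda>i. if i \<in> K j then {True} else UNIV)"
      using K(1)[OF j] by (fastforce simp: Pi_def)
    also have "measure_pmf.prob P \<dots> =
        (\<Prod>i\<in>A. measure_pmf.prob (bernoulli_pmf t) (if i \<in> K j then {True} else UNIV))"
      unfolding P_def using A by (rule measure_Pi_pmf_Pi)
    also have "\<dots> = (\<Prod>i\<in>A. if i \<in> K j then t else 1)"
      using t by (intro prod.cong) (auto simp: measure_pmf_single)
    also have "\<dots> = (\<Prod>i\<in>K j. t)"
      using A K(1)[OF j] by (simp add: prod.If_cases Int_absorb1)
    finally show ?thesis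
      using K(2)[OF j] by simp
  qed
  have S: "(\<Sum>j\<in>L. X j f) = real (card {j\<in>L. \<forall>i\<in>K j. f i})" for f
    using L by (simp add: X_def of_bool_def sum.If_cases Int_def)
  have "measure_pmf.prob P {f. x \<le> \<bar>real (card {j\<in>L. \<forall>i\<in>K j. f i}) - real (card L) * t ^ c\<bar>}
      \<le> 2 * exp (- 2 * x\<^sup>2 / real (card L))"
    using H.Hoeffding_ineq_abs_ge[of x] x False L by (simp add: E S card_gt_0_iff)
  also have "\<dots> \<le> 2 * exp (- 2 * x\<^sup>2 / m)"
    using m False L by (auto simp: card_gt_0_iff intro!: frac_le)
  finally show ?thesis
    by (simp add: P_def)
qed

section \<open>Thinning a set of integers\<close>

text \<open>The strict inequality lists each pair \<open>{i, n - i}\<close> once, which makes pairs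
  for different \<open>i\<close> disjoint. It also omits \<open>i = n - i\<close>, which would
  survive with probability \<open>t\<close> instead of \<open>t^2\<close>.\<close>

definition pair_count :: "nat set \<Rightarrow> nat \<Rightarrow> nat" where
  "pair_count A n = card {i. 2 * i < n \<and> i \<in> A \<and> n - i \<in> A}"

lemma finite_pairs: "finite {i. 2 * i < n \<and> i \<in> A \<and> n - i \<in> (A :: nat set)}"
  by (rule finite_subset[of _ "{..<n}"]) auto

text \<open>Probabilistic method: one bad event for the size and \<open>2 * d + 1\<close> for the
  pair counts each have probability at most \<open>b\<close>. Their sum
  \<open>(2 * d + 2) * b\<close> is the left side of \<open>small\<close>, so some outcome avoids
  them all.\<close>

lemma ex_thinning:
  fixes A :: "nat set" and t \<epsilon> :: real
  assumes A: "A \<subseteq> {..<d}" and t: "0 < t" "t \<le> 1" and \<epsilon>: "\<epsilon> > 0"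
    and small: "(4 * real d + 4) * exp (- 2 * \<epsilon>\<^sup>2 * t ^ 4 * real d) < 1"
  obtains S where "S \<subseteq> A" "\<bar>real (card S) - t * real (card A)\<bar> < \<epsilon> * t * real d"
    "\<And>n. n \<le> 2 * d \<Longrightarrow> real (pair_count S n) < t\<^sup>2 * real (pair_count A n) + \<epsilon> * t\<^sup>2 * real d"
proof -
  have d: "d > 0"
    using small by (cases d) auto
  define P where "P = Pi_pmf A False (\<lambda>_. bernoulli_pmf t)"
  define L where "L = (\<lambda>n. {i. 2 * i < n \<and> i \<in> A \<and> n - i \<in> A})"
  define b where "b = 2 * exp (- 2 * \<epsilon>\<^sup>2 * t ^ 4 * real d)"
  \<comment> \<open>Both events are phrased through blocks to fit the concentration lemma:
    singletons with \<open>c = 1\<close> here, two-element blocks \<open>{j, n - j}\<close> with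
    \<open>c = 2\<close> in \<open>E\<close>.\<close>
  define E0 where "E0 = {f. \<epsilon> * t * real d \<le>
      \<bar>real (card {j\<in>A. \<forall>i\<in>{j}. f i}) - real (card A) * t ^ 1\<bar>}"
  define E where "E = (\<lambda>n. {f. \<epsilon> * t\<^sup>2 * real d \<le>
      \<bar>real (card {j\<in>L n. \<forall>i\<in>{j, n - j}. f i}) - real (card (L n)) * t\<^sup>2\<bar>})"
  have fin_A: "finite A"
    using A finite_subset by blast
  have cd: "real (card B) \<le> real d" if "B \<subseteq> {..<d}" for B
    using card_mono[OF _ that] by simp
  have "measure_pmf.prob P E0 \<le> 2 * exp (- 2 * (\<epsilon> * t * real d)\<^sup>2 / real d)"
    unfolding P_def E0_def
    by (rule binomial_subset_concentration)
       (use A fin_A t \<epsilon> d cd in \<open>auto simp: disjoint_family_on_def\<close>)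
  \<comment> \<open>The size estimate has \<open>t^2\<close> in its exponent; since
    \<open>t \<le> 1\<close>, it is at least as strong as the bound with \<open>t^4\<close>.\<close>
  also have "\<dots> \<le> b"
  proof -
    have "t ^ 4 \<le> t\<^sup>2"
      using t by (intro power_decreasing) auto
    then have "\<epsilon>\<^sup>2 * t ^ 4 * real d \<le> \<epsilon>\<^sup>2 * t\<^sup>2 * real d"
      by (intro mult_right_mono mult_left_mono) auto
    then show ?thesis
      using d by (simp add: b_def power_mult_distrib power2_eq_square[of "real d"])
  qed
  finally have E0: "measure_pmf.prob P E0 \<le> b" .
  have E: "measure_pmf.prob P (E n) \<le> b" if n: "n \<le> 2 * d" for n
  proof -
    have "measure_pmf.prob P (E n) \<le> 2 * exp (- 2 * (\<epsilon> * t\<^sup>2 * real d)\<^sup>2 / real d)"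
      unfolding P_def E_def
    proof (rule binomial_subset_concentration)
      show "finite (L n)"
        unfolding L_def by (rule finite_pairs)
      show "real (card (L n)) \<le> real d"
        by (rule cd) (use A in \<open>auto simp: L_def\<close>)
    qed (use fin_A t \<epsilon> d in \<open>auto simp: disjoint_family_on_def L_def card_insert_if\<close>)
    also have "\<dots> = b"
      using d by (simp add: b_def power_mult_distrib power2_eq_square[of "real d"] flip: power_mult)
    finally show ?thesis .
  qed
  have "measure_pmf.prob P (E0 \<union> (\<Union>n\<le>2*d. E n)) \<le>
      measure_pmf.prob P E0 + measure_pmf.prob P (\<Union>n\<le>2*d. E n)"
    by (rule measure_Un_le) auto
  also have "measure_pmf.prob P (\<Union>n\<le>2*d. E n) \<le> (\<Sum>n\<le>2*d. measure_pmf.prob P (E n))"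
    by (rule measure_pmf.finite_measure_subadditive_finite) auto
  also have "\<dots> \<le> (\<Sum>n\<le>2*d. b)"
    by (rule sum_mono) (use E in auto)
  also have "measure_pmf.prob P E0 + (\<Sum>n\<le>2*d. b) \<le> b + (2 * real d + 1) * b"
    using E0 by (simp add: algebra_simps)
  also have "\<dots> < 1"
    using small by (simp add: b_def algebra_simps)
  finally have "E0 \<union> (\<Union>n\<le>2*d. E n) \<noteq> UNIV"
    by auto
  then obtain f where f: "f \<notin> E0" "\<And>n. n \<le> 2 * d \<Longrightarrow> f \<notin> E n"
    by auto
  show thesis
  proof (rule that[of "{i\<in>A. f i}"])
    show "\<bar>real (card {i\<in>A. f i}) - t * real (card A)\<bar> < \<epsilon> * t * real d"
      using f(1) by (simp add: E0_def mult.commute)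
    fix n assume "n \<le> 2 * d"
    moreover have "{j\<in>L n. \<forall>i\<in>{j, n - j}. f i} =
        {i. 2 * i < n \<and> i \<in> {i\<in>A. f i} \<and> n - i \<in> {i\<in>A. f i}}"
      by (auto simp: L_def)
    ultimately show "real (pair_count {i\<in>A. f i} n) <
        t\<^sup>2 * real (pair_count A n) + \<epsilon> * t\<^sup>2 * real d"
      using f(2)[of n] by (simp add: E_def pair_count_def L_def mult.commute)
  qed auto
qed

section \<open>Pair counts and ordered representations of an integer\<close>

lemma pair_count_mono:
  assumes "A \<subseteq> B"
  shows "pair_count A n \<le> pair_count B n"
  unfolding pair_count_def by (rule card_mono[OF finite_pairs]) (use assms in auto)

text \<open>As \<open>d\<close> exceeds every element of \<open>S\<close>, it can only be the larger
  member of a new pair, whose smaller member is then \<open>n - d\<close>.\<close>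

lemma pair_count_insert_le:
  assumes "S \<subseteq> {..<d}"
  shows "pair_count (insert d S) n \<le> pair_count S n + 1"
proof -
  have "{i. 2 * i < n \<and> i \<in> insert d S \<and> n - i \<in> insert d S} \<subseteq>
      insert (n - d) {i. 2 * i < n \<and> i \<in> S \<and> n - i \<in> S}"
    using assms by auto
  from card_mono[OF _ this] show ?thesis
    unfolding pair_count_def using finite_pairs[of n S] by (simp add: card_insert_if split: if_splits)
qed

lemma pair_count_eq_0:
  assumes "A \<subseteq> {..d}" "n > 2 * d"
  shows "pair_count A n = 0"
proof -
  have "{i. 2 * i < n \<and> i \<in> A \<and> n - i \<in> A} = {}"
    using assms by fastforce
  then show ?thesis
    by (simp only: pair_count_def) simp
qed

text \<open>The map \<open>i\<close> to \<open>n - i\<close> exchanges the solutions below and above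
  \<open>n / 2\<close>; only the midpoint is fixed.\<close>

lemma card_ordered_pairs:
  "card {i. i \<le> n \<and> i \<in> A \<and> n - i \<in> A} = 2 * pair_count A n + of_bool (even n \<and> n div 2 \<in> A)"
proof -
  define B where "B = {i. 2 * i < n \<and> i \<in> A \<and> n - i \<in> A}"
  define C where "C = (if even n \<and> n div 2 \<in> A then {n div 2} else {})"
  have fin: "finite B" "finite C"
    by (auto simp: B_def C_def finite_pairs)
  have "{i. i \<le> n \<and> i \<in> A \<and> n - i \<in> A} = B \<union> (\<lambda>i. n - i) ` B \<union> C"
  proof (intro equalityI subsetI)
    fix i assume i: "i \<in> {i. i \<le> n \<and> i \<in> A \<and> n - i \<in> A}"
    consider "2 * i < n" | "2 * i = n" | "2 * (n - i) < n" "i = n - (n - i)"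
      using i by fastforce
    then show "i \<in> B \<union> (\<lambda>i. n - i) ` B \<union> C"
    proof cases
      case 3
      then show ?thesis using i by (intro UnI1 UnI2 image_eqI[of _ _ "n - i"]) (auto simp: B_def)
    qed (use i in \<open>auto simp: B_def C_def\<close>)
  qed (auto simp: B_def C_def split: if_splits elim!: evenE)
  also have "card \<dots> = card (B \<union> (\<lambda>i. n - i) ` B) + card C"
  proof (rule card_Un_disjoint)
    have "2 * i \<noteq> n" if "i \<in> B \<union> (\<lambda>i. n - i) ` B" for i
      using that by (fastforce simp: B_def)
    moreover have "2 * i = n" if "i \<in> C" for i
      using that by (auto simp: C_def split: if_splits)
    ultimately show "(B \<union> (\<lambda>i. n - i) ` B) \<inter> C = {}"
      by (meson disjoint_iff)
  qed (intro finite_UnI finite_imageI fin)+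
  also have "card (B \<union> (\<lambda>i. n - i) ` B) = card B + card ((\<lambda>i. n - i) ` B)"
  proof (rule card_Un_disjoint)
    have "2 * i < n" if "i \<in> B" for i
      using that by (simp add: B_def)
    moreover have "\<not> 2 * i < n" if "i \<in> (\<lambda>i. n - i) ` B" for i
      using that by (fastforce simp: B_def)
    ultimately show "B \<inter> (\<lambda>i. n - i) ` B = {}"
      by (meson disjoint_iff)
  qed (intro finite_imageI fin)+
  also have "card ((\<lambda>i. n - i) ` B) = card B"
    by (intro card_image inj_onI) (auto simp: B_def)
  finally show ?thesis
    by (simp add: pair_count_def B_def C_def)
qed

section \<open>Newman polynomials and their supports\<close>

definition supp :: "real poly \<Rightarrow> nat set" where
  "supp p = {i. coeff p i \<noteq> 0}"

lemma supp_subset: "supp p \<subseteq> {..degree p}"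
  by (auto simp: supp_def le_degree)

lemma ex_newman_supp:
  assumes "finite A"
  obtains p where "newman p" "supp p = A"
proof (rule that)
  have *: "coeff (\<Sum>i\<in>A. monom (1::real) i) j = of_bool (j \<in> A)" for j
    using assms by (simp add: coeff_sum of_bool_def)
  show "newman (\<Sum>i\<in>A. monom 1 i)" "supp (\<Sum>i\<in>A. monom 1 i) = A"
    by (auto simp: newman_def supp_def *)
qed

lemma newman_coeff:
  assumes "newman p"
  shows "coeff p i = of_bool (i \<in> supp p)"
  using assms by (auto simp: newman_def supp_def)

lemma newman_norm1:
  assumes "newman p"
  shows "poly_norm1 p = real (card (supp p))"
proof -
  have "poly_norm1 p = (\<Sum>j\<in>{0..degree p}. of_bool (j \<in> supp p))"
    using newman_coeff[OF assms] by (simp add: poly_norm1_def)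
  also have "\<dots> = real (card ({0..degree p} \<inter> supp p))"
    by (simp add: of_bool_def sum.If_cases)
  also have "{0..degree p} \<inter> supp p = supp p"
    using supp_subset[of p] by auto
  finally show ?thesis .
qed

lemma newman_coeff_square:
  assumes "newman p"
  shows "coeff (p ^ 2) n =
    2 * real (pair_count (supp p) n) + of_bool (even n \<and> n div 2 \<in> supp p)"
proof -
  have "coeff (p ^ 2) n = (\<Sum>i\<le>n. of_bool (i \<in> supp p \<and> n - i \<in> supp p))"
    using newman_coeff[OF assms] by (simp add: power2_eq_square coeff_mult of_bool_conj)
  also have "\<dots> = real (card {i. i \<le> n \<and> i \<in> supp p \<and> n - i \<in> supp p})"
    by (simp add: of_bool_def sum.If_cases Int_def)
  finally show ?thesis
    by (simp add: card_ordered_pairs)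
qed

lemma coeff_le_norm_inf: "\<bar>coeff p n\<bar> \<le> poly_norm_inf p"
proof (cases "n \<le> degree p")
  case True
  then show ?thesis by (auto simp: poly_norm_inf_def intro!: Max_ge)
next
  case False
  then have "\<bar>coeff p n\<bar> \<le> \<bar>coeff p 0\<bar>"
    by (simp add: coeff_eq_0)
  also have "\<dots> \<le> poly_norm_inf p"
    by (auto simp: poly_norm_inf_def intro!: Max_ge)
  finally show ?thesis .
qed

lemma norm_inf_le:
  assumes "\<And>n. \<bar>coeff p n\<bar> \<le> B"
  shows "poly_norm_inf p \<le> B"
  using assms by (auto simp: poly_norm_inf_def)

text \<open>Only exponents below \<open>d\<close> are thinned, and \<open>d\<close> is put back to
  preserve the degree. The two-sided norm estimate serves to show sparsity; the lower bound, free of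
  an additive constant, serves as the denominator of \<open>poly_R q\<close>.\<close>

lemma ex_thinned_newman:
  fixes p :: "real poly" and t \<epsilon> :: real
  defines "d \<equiv> degree p"
  assumes p: "newman p" and t: "0 < t" "t \<le> 1" and \<epsilon>: "\<epsilon> > 0"
    and small: "(4 * real d + 4) * exp (- 2 * \<epsilon>\<^sup>2 * t ^ 4 * real d) < 1"
  obtains q where "newman q" "degree q = d"
    "\<bar>poly_norm1 q - t * poly_norm1 p\<bar> \<le> \<epsilon> * t * real d + 1"
    "poly_norm1 q \<ge> t * (poly_norm1 p - \<epsilon> * real d)"
    "poly_norm_inf (q ^ 2) \<le> t\<^sup>2 * poly_norm_inf (p ^ 2) + 2 * \<epsilon> * t\<^sup>2 * real d + 3"
proof -
  define A where "A = supp p - {d}"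
  have d: "d > 0"
    using small by (cases d) auto
  have A: "A \<subseteq> {..<d}"
    using supp_subset[of p] by (auto simp: A_def d_def)
  then have fin_A: "finite A"
    using finite_subset by blast
  have d_in: "d \<in> supp p"
    using d leading_coeff_neq_0[of p] by (auto simp: supp_def d_def)
  then have "supp p = insert d A"
    by (auto simp: A_def)
  moreover have "d \<notin> A"
    by (simp add: A_def)
  ultimately have N: "poly_norm1 p = real (card A) + 1"
    using fin_A by (simp add: newman_norm1[OF p])
  obtain S where S: "S \<subseteq> A" "\<bar>real (card S) - t * real (card A)\<bar> < \<epsilon> * t * real d"
    and pc: "\<And>n. n \<le> 2 * d \<Longrightarrow>
      real (pair_count S n) < t\<^sup>2 * real (pair_count A n) + \<epsilon> * t\<^sup>2 * real d"
    using ex_thinning[OF A t \<epsilon> small] by metis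
  have fin_S: "finite S"
    using S(1) fin_A by (rule finite_subset)
  obtain q where q: "newman q" "supp q = insert d S"
    using ex_newman_supp[of "insert d S"] fin_S by auto
  have Sd: "S \<subseteq> {..<d}"
    using S(1) A by auto
  then have "d \<notin> S"
    by auto
  then have M: "poly_norm1 q = real (card S) + 1"
    using fin_S by (simp add: newman_norm1[OF q(1)] q(2))
  show thesis
  proof (rule that[OF q(1)])
    have "coeff q d \<noteq> 0"
      using q(2) by (auto simp: supp_def)
    moreover have "coeff q i = 0" if "i > d" for i
    proof -
      have "i \<notin> supp q"
        using that Sd by (auto simp: q(2))
      then show ?thesis
        by (simp add: supp_def)
    qed
    ultimately show "degree q = d"
      by (intro antisym degree_le le_degree) auto
    have *: "t * poly_norm1 p = t * real (card A) + t"
      by (simp add: N algebra_simps)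
    show "\<bar>poly_norm1 q - t * poly_norm1 p\<bar> \<le> \<epsilon> * t * real d + 1"
      using S(2) t unfolding * M by linarith
    \<comment> \<open>The exponent \<open>d\<close> contributes 1 to the norm of \<open>q\<close>
      but only \<open>t \<le> 1\<close> to \<open>t * poly_norm1 p\<close>, so no additive loss
      remains.\<close>
    show "poly_norm1 q \<ge> t * (poly_norm1 p - \<epsilon> * real d)"
      using S(2) t * M by (simp add: algebra_simps)
    show "poly_norm_inf (q ^ 2) \<le> t\<^sup>2 * poly_norm_inf (p ^ 2) + 2 * \<epsilon> * t\<^sup>2 * real d + 3"
    proof (rule norm_inf_le)
      fix n
      \<comment> \<open>The half appears because a coefficient of \<open>p ^ 2\<close> counts every
        unordered pair twice. For \<open>n > 2 * d\<close>, outside the range of the thinning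
        estimate, there are no pairs.\<close>
      have "real (pair_count S n) \<le> t\<^sup>2 * (poly_norm_inf (p ^ 2) / 2) + \<epsilon> * t\<^sup>2 * real d"
      proof (cases "n \<le> 2 * d")
        case True
        have "2 * real (pair_count A n) \<le> 2 * real (pair_count (supp p) n)"
          using pair_count_mono[of A "supp p" n] by (simp add: A_def)
        also have "\<dots> \<le> coeff (p ^ 2) n"
          by (simp add: newman_coeff_square[OF p])
        also have "\<dots> \<le> poly_norm_inf (p ^ 2)"
          using coeff_le_norm_inf[of "p ^ 2" n] by simp
        finally have "t\<^sup>2 * real (pair_count A n) \<le> t\<^sup>2 * (poly_norm_inf (p ^ 2) / 2)"
          by (intro mult_left_mono) auto
        with pc[OF True] show ?thesis by linarith
      next
        case False
        then have "pair_count S n = 0"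
          using Sd by (intro pair_count_eq_0[of S d]) auto
        moreover have "poly_norm_inf (p ^ 2) \<ge> 0"
          using coeff_le_norm_inf[of "p ^ 2" 0] by linarith
        ultimately show ?thesis
          using \<epsilon> by simp
      qed
      \<comment> \<open>The constant 3 is 2 for the at most one pair created by \<open>d\<close>,
        plus 1 for the diagonal term.\<close>
      moreover have "\<bar>coeff (q ^ 2) n\<bar> \<le> 2 * real (pair_count S n) + 3"
        using pair_count_insert_le[OF Sd, of n]
        by (simp add: newman_coeff_square[OF q(1)] q(2))
      ultimately show "\<bar>coeff (q ^ 2) n\<bar> \<le>
          t\<^sup>2 * poly_norm_inf (p ^ 2) + 2 * \<epsilon> * t\<^sup>2 * real d + 3"
        by simp
    qed
  qed
qed

text \<open>The factor \<open>t^2\<close> cancels in the quotient. The condition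
  \<open>\<epsilon> * t^2 * d \<ge> 3\<close> absorbs the additive 3, and
  \<open>poly_norm1 p \<ge> c * d\<close> turns errors of size \<open>\<epsilon> * d\<close> into
  relative errors.\<close>

lemma poly_R_thinned_le:
  fixes p q :: "real poly" and c t \<epsilon> \<rho> d :: real
  assumes d: "d > 0" and t: "t > 0" "\<epsilon> * t\<^sup>2 * d \<ge> 3" and c: "0 < \<epsilon>" "\<epsilon> < c"
    and p: "poly_norm1 p \<ge> c * d" "poly_R p \<le> \<rho> / d"
    and q: "poly_norm1 q \<ge> t * (poly_norm1 p - \<epsilon> * d)"
      "poly_norm_inf (q ^ 2) \<le> t\<^sup>2 * poly_norm_inf (p ^ 2) + 2 * \<epsilon> * t\<^sup>2 * d + 3"
  shows "poly_R q \<le> (\<rho> + 3 * \<epsilon> / c\<^sup>2) / (1 - \<epsilon> / c)\<^sup>2 / d"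
proof -
  define N where "N = poly_norm1 p"
  define M where "M = poly_norm_inf (p ^ 2)"
  have N: "N \<ge> c * d" "N > 0"
    using p(1) c d by (auto simp: N_def intro: less_le_trans[of 0 "c * d"])
  have \<epsilon>c: "1 - \<epsilon> / c > 0"
    using c by simp
  have "\<epsilon> * d \<le> \<epsilon> / c * N"
    using N c by (simp add: field_simps)
  then have "t * (N * (1 - \<epsilon> / c)) \<le> t * (N - \<epsilon> * d)"
    using t by (intro mult_left_mono) (auto simp: algebra_simps)
  then have q1: "t * (N * (1 - \<epsilon> / c)) \<le> poly_norm1 q"
    using q(1) by (simp add: N_def)
  have pos: "t * (N * (1 - \<epsilon> / c)) > 0"
    using t N \<epsilon>c by simp
  have q2: "poly_norm_inf (q ^ 2) \<le> t\<^sup>2 * (M + 3 * \<epsilon> * d)"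
    using q(2) t(2) by (simp add: M_def algebra_simps)
  have M0: "M + 3 * \<epsilon> * d \<ge> 0"
    using coeff_le_norm_inf[of "p ^ 2" 0] c d by (simp add: M_def)
  have "poly_R q \<le> t\<^sup>2 * (M + 3 * \<epsilon> * d) / (t * (N * (1 - \<epsilon> / c)))\<^sup>2"
    unfolding poly_R_def using q1 q2 pos M0 by (intro frac_le power_mono) auto
  also have "\<dots> = (M / N\<^sup>2 + 3 * \<epsilon> * d / N\<^sup>2) / (1 - \<epsilon> / c)\<^sup>2"
    using t by (simp add: power_mult_distrib add_divide_distrib)
  also have "\<dots> \<le> (\<rho> / d + 3 * \<epsilon> / c\<^sup>2 / d) / (1 - \<epsilon> / c)\<^sup>2"
  proof (intro divide_right_mono add_mono)
    show "M / N\<^sup>2 \<le> \<rho> / d"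
      using p(2) by (simp add: M_def N_def poly_R_def)
    have "3 * \<epsilon> * d / N\<^sup>2 \<le> 3 * \<epsilon> * d / (c * d)\<^sup>2"
      using N c d by (intro divide_left_mono power_mono) auto
    also have "\<dots> = 3 * \<epsilon> / c\<^sup>2 / d"
      using d by (simp add: power2_eq_square)
    finally show "3 * \<epsilon> * d / N\<^sup>2 \<le> 3 * \<epsilon> / c\<^sup>2 / d" .
  qed auto
  also have "\<dots> = (\<rho> + 3 * \<epsilon> / c\<^sup>2) / (1 - \<epsilon> / c)\<^sup>2 / d"
  proof -
    have "(a / d + b / d) / e = (a + b) / e / d" for a b e :: real
      by (simp add: mult.commute flip: add_divide_distrib)
    then show ?thesis .
  qed
  finally show ?thesis .
qed

lemma newman_norm1_le_degree:
  assumes "newman p"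
  shows "poly_norm1 p \<le> real (degree p) + 1"
  using card_mono[OF _ supp_subset[of p]] by (simp add: newman_norm1[OF assms])

section \<open>Choice of parameters and passage to the limit\<close>

theorem theorem1:
  fixes p :: "nat \<Rightarrow> real poly" and c0 \<rho> :: real
  assumes "\<And>n. newman (p n)"
    and "filterlim (\<lambda>n. degree (p n)) at_top sequentially"
    and "c0 > 0" and "\<rho> > 0"
    and "\<And>n. poly_norm1 (p n) \<ge> c0 * real (degree (p n))"
    and "\<And>n. poly_R (p n) \<le> \<rho> * (1 / real (degree (p n)))"
  shows "\<forall>\<rho>'>\<rho>. \<exists>q :: nat \<Rightarrow> real poly.
           (\<forall>n. newman (q n) \<and> degree (q n) > 0) \<and>
           filterlim (\<lambda>n. degree (q n)) at_top sequentially \<and>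
           (\<lambda>n. poly_norm1 (q n)) \<in> o[sequentially](\<lambda>n. real (degree (q n))) \<and>
           (\<forall>n. poly_R (q n) \<le> \<rho>' * (1 / real (degree (q n))))"
proof (intro allI impI)
  fix \<rho>' assume \<rho>': "\<rho>' > \<rho>"
  \<comment> \<open>The factor from \<open>poly_R_thinned_le\<close> is continuous in
    \<open>\<epsilon>\<close> with value \<open>\<rho>\<close> at 0, so it stays below
    \<open>\<rho>'\<close> for small \<open>\<epsilon>\<close>.\<close>
  have "((\<lambda>\<epsilon>. (\<rho> + 3 * \<epsilon> / c0\<^sup>2) / (1 - \<epsilon> / c0)\<^sup>2) \<longlongrightarrow> (\<rho> + 3 * 0 / c0\<^sup>2) / (1 - 0 / c0)\<^sup>2) (at_right 0)"
    using \<open>c0 > 0\<close> by (intro tendsto_intros) auto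
  then have "eventually (\<lambda>\<epsilon>. (\<rho> + 3 * \<epsilon> / c0\<^sup>2) / (1 - \<epsilon> / c0)\<^sup>2 < \<rho>') (at_right 0)"
    using \<rho>' by (intro order_tendstoD) auto
  moreover have "eventually (\<lambda>\<epsilon>. \<epsilon> \<in> {0<..<c0}) (at_right 0)"
    using \<open>c0 > 0\<close> by (rule eventually_at_right_real)
  ultimately have "eventually (\<lambda>\<epsilon>. (\<rho> + 3 * \<epsilon> / c0\<^sup>2) / (1 - \<epsilon> / c0)\<^sup>2 < \<rho>' \<and> \<epsilon> \<in> {0<..<c0})
      (at_right 0)"
    by (rule eventually_conj)
  then obtain \<epsilon> where \<epsilon>: "0 < \<epsilon>" "\<epsilon> < c0" "(\<rho> + 3 * \<epsilon> / c0\<^sup>2) / (1 - \<epsilon> / c0)\<^sup>2 < \<rho>'"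
    using eventually_happens'[OF trivial_limit_at_right_real] by force
  \<comment> \<open>With this exponent \<open>t\<close> tends to 0, while
    \<open>t^4 * d = d powr (1/2)\<close> outgrows \<open>ln d\<close> and
    \<open>t^2 * d = d powr (3/4)\<close> tends to infinity.\<close>
  define t :: "nat \<Rightarrow> real" where "t = (\<lambda>d. real d powr (- 1 / 8))"
  have "eventually (\<lambda>d. d > 0 \<and> t d \<le> 1 \<and> \<epsilon> * (t d)\<^sup>2 * real d \<ge> 3 \<and>
      (4 * real d + 4) * exp (- 2 * \<epsilon>\<^sup>2 * t d ^ 4 * real d) < 1) sequentially"
    unfolding t_def using \<epsilon>(1) by (intro eventually_conj eventually_gt_at_top) real_asymp+
  then obtain D where D: "\<And>d. d \<ge> D \<Longrightarrow> d > 0 \<and> t d \<le> 1 \<and> \<epsilon> * (t d)\<^sup>2 * real d \<ge> 3 \<and>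
      (4 * real d + 4) * exp (- 2 * \<epsilon>\<^sup>2 * t d ^ 4 * real d) < 1"
    by (auto simp: eventually_sequentially)
  \<comment> \<open>Dropping the first \<open>n0\<close> polynomials makes the eventual estimates
    hold for every index.\<close>
  from assms(2) obtain n0 where n0: "\<And>n. n \<ge> n0 \<Longrightarrow> degree (p n) \<ge> D"
    by (auto simp: filterlim_at_top eventually_sequentially)
  \<comment> \<open>This bound has order \<open>d powr (7/8)\<close>; it comes from the two-sided
    norm estimate and \<open>poly_norm1 p \<le> d + 1\<close>.\<close>
  define h where "h = (\<lambda>d. t d * (real d + 1) + \<epsilon> * t d * real d + 1)"
  have "\<exists>q. newman q \<and> degree q = degree (p (n + n0)) \<and> poly_norm1 q \<le> h (degree q) \<and>
      poly_R q \<le> \<rho>' / real (degree q)" for n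
  proof -
    define d where "d = degree (p (n + n0))"
    have d: "d > 0" "t d \<le> 1" "\<epsilon> * (t d)\<^sup>2 * real d \<ge> 3"
        "(4 * real d + 4) * exp (- 2 * \<epsilon>\<^sup>2 * t d ^ 4 * real d) < 1"
      using D[of d] n0[of "n + n0"] by (auto simp: d_def)
    have t0: "t d > 0"
      using d(1) by (simp add: t_def)
    obtain q where q: "newman q" "degree q = d"
      "\<bar>poly_norm1 q - t d * poly_norm1 (p (n + n0))\<bar> \<le> \<epsilon> * t d * real d + 1"
      "poly_norm1 q \<ge> t d * (poly_norm1 (p (n + n0)) - \<epsilon> * real d)"
      "poly_norm_inf (q ^ 2) \<le>
         (t d)\<^sup>2 * poly_norm_inf (p (n + n0) ^ 2) + 2 * \<epsilon> * (t d)\<^sup>2 * real d + 3"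
      using ex_thinned_newman[OF assms(1)[of "n + n0"] t0 d(2) \<epsilon>(1)] d(4) unfolding d_def by metis
    have "t d * poly_norm1 (p (n + n0)) \<le> t d * (real d + 1)"
      using newman_norm1_le_degree[OF assms(1)] t0 by (intro mult_left_mono) (auto simp: d_def)
    then have "poly_norm1 q \<le> h d"
      using q(3) by (simp add: h_def)
    moreover have "poly_R q \<le> (\<rho> + 3 * \<epsilon> / c0\<^sup>2) / (1 - \<epsilon> / c0)\<^sup>2 / real d"
      using poly_R_thinned_le[OF _ t0 d(3) \<epsilon>(1,2) _ _ q(4,5)] d(1)
        assms(5)[of "n + n0"] assms(6)[of "n + n0"] by (simp add: d_def)
    moreover have "\<dots> \<le> \<rho>' / real d"
      using \<epsilon>(3) by (intro divide_right_mono) auto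
    ultimately show ?thesis
      using q(1,2) by (auto simp: d_def)
  qed
  then obtain q where q: "\<And>n. newman (q n)" "\<And>n. degree (q n) = degree (p (n + n0))"
    "\<And>n. poly_norm1 (q n) \<le> h (degree (q n))" "\<And>n. poly_R (q n) \<le> \<rho>' / real (degree (q n))"
    by metis
  have lim: "filterlim (\<lambda>n. degree (q n)) at_top sequentially"
    using filterlim_compose[OF assms(2) filterlim_add_const_nat_at_top] by (simp add: q(2))
  have "h \<in> o(\<lambda>d. real d)"
    unfolding h_def t_def by real_asymp
  then have "(\<lambda>n. h (degree (q n))) \<in> o(\<lambda>n. real (degree (q n)))"
    by (rule landau_o.small.compose) (rule lim)
  moreover have "(\<lambda>n. poly_norm1 (q n)) \<in> O(\<lambda>n. h (degree (q n)))"
    by (rule bigoI[of _ 1]) (use q(3) in \<open>auto simp: newman_norm1[OF q(1)] intro!: always_eventually intro: order_trans[OF _ abs_ge_self]\<close>)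
  ultimately have "(\<lambda>n. poly_norm1 (q n)) \<in> o(\<lambda>n. real (degree (q n)))"
    by (rule landau_o.big_small_trans[rotated])
  \<comment> \<open>Positivity makes \<open>1 / real (degree (q n))\<close> a true reciprocal rather
    than the default value \<open>1 / 0 = 0\<close>.\<close>
  moreover have "degree (q n) > 0" for n
    using D n0 by (simp add: q(2))
  ultimately show "\<exists>q :: nat \<Rightarrow> real poly.
           (\<forall>n. newman (q n) \<and> degree (q n) > 0) \<and>
           filterlim (\<lambda>n. degree (q n)) at_top sequentially \<and>
           (\<lambda>n. poly_norm1 (q n)) \<in> o[sequentially](\<lambda>n. real (degree (q n))) \<and>
           (\<forall>n. poly_R (q n) \<le> \<rho>' * (1 / real (degree (q n))))"
    using q(1,4) lim by (intro exI[of _ q]) auto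
qed

end
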